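(* Let $X$ and $Y$ be real Banach spaces, let $x\in S_X$, $y\in S_Y$, let $N$ be an absolute normalised norm on $\mathbb{R}^2$, and let $a,b\ge 0$ be such that $N(a,b)=1$. Assume that $(ax,by)$ is a $\Delta$-point in $X\oplus_N Y$. (a) If $b\neq 1$, then $x$ is a $\Delta$-point in $X$. (b) If $a\neq 1$, then $y$ is a $\Delta$-point in $Y$.
   Context: All Banach spaces are real. $B_X$ and $S_X$ denote the closed unit ball and unit sphere of $X$. For $x\in S_X$ and $\varepsilon>0$ put $\Delta_\varepsilon(x)=\{y\in B_X : \|x-y\|\ge 2-\varepsilon\}$. A point $x\in S_X$ is a $\Delta$-point of $X$ if $x\in\overline{\mathrm{conv}}\,\Delta_\varepsilon(x)$ for every $\varepsilon>0$. A norm $N$ on $\mathbb{R}^2$ is absolute if $N(a,b)=N(|a|,|b|)$ for all $(a,b)\in\mathbb{R}^2$, and normalised if $N(1,0)=N(0,1)=1$. For such $N$, $X\oplus_N Y$ is the direct sum $X\oplus Y$ with norm $\|(x,y)\|_N=N(\|x\|,\|y\|)$. *)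

theory Defs
  imports "HOL-Analysis.Analysis"
begin

text \<open>
  The norm of \<open>X \<oplus>\<^sub>N Y\<close> depends on the term \<open>N\<close>, so it cannot be a type class instance on
  \<open>'a \<times> 'b\<close> (whose class norm is the Euclidean combination). Norms are therefore passed as functions
  on a real vector space, and closures are taken in the metric topology of the given norm. For the
  class norm this yields the usual notions, see \<open>Delta_point_norm_iff\<close> below.
\<close>

definition is_norm :: "('v::real_vector \<Rightarrow> real) \<Rightarrow> bool" where
  "is_norm n \<longleftrightarrow>
     (\<forall>v. 0 \<le> n v) \<and> (\<forall>v. n v = 0 \<longleftrightarrow> v = 0) \<and>
     (\<forall>c v. n (c *\<^sub>R v) = \<bar>c\<bar> * n v) \<and> (\<forall>v w. n (v + w) \<le> n v + n w)"

definition absolute_norm :: "(real \<times> real \<Rightarrow> real) \<Rightarrow> bool" where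
  "absolute_norm N \<longleftrightarrow> is_norm N \<and> (\<forall>a b. N (a, b) = N (\<bar>a\<bar>, \<bar>b\<bar>))"

definition normalised :: "(real \<times> real \<Rightarrow> real) \<Rightarrow> bool" where
  "normalised N \<longleftrightarrow> N (1, 0) = 1 \<and> N (0, 1) = 1"

definition sum_norm ::
    "(real \<times> real \<Rightarrow> real) \<Rightarrow> 'a::real_normed_vector \<times> 'b::real_normed_vector \<Rightarrow> real" where
  "sum_norm N = (\<lambda>(x, y). N (norm x, norm y))"

abbreviation norm_topology :: "('v::real_vector \<Rightarrow> real) \<Rightarrow> 'v topology" where
  "norm_topology n \<equiv> Metric_space.mtopology UNIV (\<lambda>v w. n (v - w))"

definition Delta_set :: "('v::real_vector \<Rightarrow> real) \<Rightarrow> real \<Rightarrow> 'v \<Rightarrow> 'v set" where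
  "Delta_set n \<epsilon> x = {y. n y \<le> 1 \<and> n (x - y) \<ge> 2 - \<epsilon>}"

definition Delta_point :: "('v::real_vector \<Rightarrow> real) \<Rightarrow> 'v \<Rightarrow> bool" where
  "Delta_point n x \<longleftrightarrow>
     n x = 1 \<and> (\<forall>\<epsilon>>0. x \<in> norm_topology n closure_of (convex hull (Delta_set n \<epsilon> x)))"

lemma is_norm_norm: "is_norm (norm :: 'a::real_normed_vector \<Rightarrow> real)"
  by (simp add: is_norm_def norm_triangle_ineq)

lemma is_norm_Metric_space:
  assumes "is_norm n"
  shows "Metric_space UNIV (\<lambda>v w. n (v - w))"
proof
  fix u v w :: 'a
  have scale: "n (c *\<^sub>R u) = \<bar>c\<bar> * n u" for c u
    using assms by (simp add: is_norm_def)
  show "0 \<le> n (u - v)" "n (u - v) = 0 \<longleftrightarrow> u = v"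
    using assms by (simp_all add: is_norm_def)
  show "n (u - v) = n (v - u)"
    using scale[of "-1" "v - u"] by simp
  have "n ((u - v) + (v - w)) \<le> n (u - v) + n (v - w)"
    using assms unfolding is_norm_def by blast
  then show "n (u - w) \<le> n (u - v) + n (v - w)"
    by simp
qed

lemma norm_topology_norm: "norm_topology (norm :: 'a::real_normed_vector \<Rightarrow> real) = euclidean"
  using mtopology_is_euclidean[where 'a='a] unfolding dist_norm by simp

lemma Delta_point_norm_iff:
  fixes x :: "'a::real_normed_vector"
  shows "Delta_point norm x \<longleftrightarrow>
    x \<in> sphere 0 1 \<and>
    (\<forall>\<epsilon>>0. x \<in> closure (convex hull {y \<in> cball 0 1. norm (x - y) \<ge> 2 - \<epsilon>}))"
  by (simp add: Delta_point_def Delta_set_def norm_topology_norm)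

lemma absolute_norm_mono:
  assumes N: "absolute_norm N" and "0 \<le> a" "a \<le> c" "0 \<le> b" "b \<le> d"
  shows "N (a, b) \<le> N (c, d)"
proof -
  have tri: "N (v + w) \<le> N v + N w" and scale: "N (t *\<^sub>R v) = \<bar>t\<bar> * N v"
    and abs: "N (r, s) = N (\<bar>r\<bar>, \<bar>s\<bar>)" for v w t r s
    using N unfolding absolute_norm_def is_norm_def by blast+
  have convex_comb: "N v \<le> K"
    if "v = t *\<^sub>R w + (1 - t) *\<^sub>R w'" "0 \<le> t" "t \<le> 1" "N w = K" "N w' = K" for v w w' t K
    using tri[of "t *\<^sub>R w" "(1 - t) *\<^sub>R w'"] that
    by (simp add: scale) (simp add: left_diff_distrib)
  define t where "t u v = (if v = 0 then 1 else (1 + u / v) / 2)" for u v :: real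
  have t: "0 \<le> t u v" "t u v \<le> 1" "u = t u v * v - (1 - t u v) * v" if "0 \<le> u" "u \<le> v" for u v
    using that by (auto simp: t_def field_simps)
  have "N (a, b) \<le> N (c, b)"
  proof (rule convex_comb)
    show "(a, b) = t a c *\<^sub>R (c, b) + (1 - t a c) *\<^sub>R (- c, b)"
      using t(3)[of a c] assms by (simp add: algebra_simps)
    show "N (- c, b) = N (c, b)" using abs[of "- c" b] abs[of c b] by simp
  qed (use t[of a c] assms in auto)
  also have "\<dots> \<le> N (c, d)"
  proof (rule convex_comb)
    show "(c, b) = t b d *\<^sub>R (c, d) + (1 - t b d) *\<^sub>R (c, - d)"
      using t(3)[of b d] assms by (simp add: algebra_simps)
    show "N (c, - d) = N (c, d)" using abs[of c "- d"] abs[of c d] by simp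
  qed (use t[of b d] assms in auto)
  finally show ?thesis .
qed

lemma is_norm_sum_norm:
  assumes N: "absolute_norm N"
  shows "is_norm (sum_norm N :: 'a::real_normed_vector \<times> 'b::real_normed_vector \<Rightarrow> real)"
proof -
  have norm: "is_norm N" using N by (simp add: absolute_norm_def)
  have scale: "N (t * r, t * s) = \<bar>t\<bar> * N (r, s)" for t r s
    using norm unfolding is_norm_def by (metis scaleR_Pair real_scaleR_def)
  have tri: "N (norm (x + x'), norm (y + y')) \<le> N (norm x, norm y) + N (norm x', norm y')"
    for x x' :: 'a and y y' :: 'b
  proof -
    have "N (norm (x + x'), norm (y + y')) \<le> N (norm x + norm x', norm y + norm y')"
      by (intro absolute_norm_mono N norm_triangle_ineq) auto
    also have "\<dots> \<le> N (norm x, norm y) + N (norm x', norm y')"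
      using norm unfolding is_norm_def by (metis add_Pair)
    finally show ?thesis .
  qed
  show ?thesis
    using norm by (auto simp: is_norm_def sum_norm_def zero_prod_def scale tri split: prod.splits)
qed

end

theory Submission
  imports Defs
begin

text \<open>
  Since \<open>b < 1\<close>, the convex function \<open>r \<mapsto> N (r, b)\<close> increases strictly at \<open>a\<close>. Hence a point
  \<open>(u, v)\<close> of the unit ball that is almost at distance \<open>2\<close> from \<open>(a x, b y)\<close> satisfies
  \<open>norm (a x - u) \<approx> a + norm u\<close>, so the direction of \<open>u\<close> is almost at distance \<open>2\<close> from \<open>x\<close>
  (when \<open>u\<close> is small it may be replaced by a multiple of \<open>- x\<close>). Averaging such points gives
  \<open>a x \<approx> S W\<close> with \<open>W\<close> in the convex hull of \<open>Delta_set norm \<epsilon> x\<close>, and the same strict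
  monotonicity forces \<open>S \<approx> a\<close>.
\<close>

section \<open>Delta-points through approximation, and their transport along isometries\<close>

lemma Delta_point_iff_approx:
  assumes "is_norm n"
  shows "Delta_point n x \<longleftrightarrow>
    n x = 1 \<and> (\<forall>\<epsilon>>0. \<forall>\<eta>>0. \<exists>z\<in>convex hull (Delta_set n \<epsilon> x). n (x - z) < \<eta>)"
proof -
  interpret Metric_space UNIV "\<lambda>v w. n (v - w)"
    by (rule is_norm_Metric_space[OF assms])
  show ?thesis
    by (auto simp: Delta_point_def metric_closure_of in_mball)
qed

lemma Delta_point_linear_isometry:
  assumes n: "is_norm n" and m: "is_norm m" and f: "linear f"
    and isometry: "\<And>v. m (f v) = n v" and x: "Delta_point n x"
  shows "Delta_point m (f x)"
proof -
  have diff: "f u - f v = f (u - v)" for u v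
    using f by (simp add: linear_diff)
  have "f ` Delta_set n \<epsilon> x \<subseteq> Delta_set m \<epsilon> (f x)" for \<epsilon>
    by (auto simp: Delta_set_def diff isometry)
  then have hull: "f ` (convex hull Delta_set n \<epsilon> x) \<subseteq> convex hull Delta_set m \<epsilon> (f x)" for \<epsilon>
    by (simp add: convex_hull_linear_image[OF f] hull_mono)
  have "\<exists>z\<in>convex hull Delta_set m \<epsilon> (f x). m (f x - z) < \<eta>" if pos: "\<epsilon> > 0" "\<eta> > 0" for \<epsilon> \<eta>
  proof -
    obtain z where "z \<in> convex hull Delta_set n \<epsilon> x" "n (x - z) < \<eta>"
      using x pos unfolding Delta_point_iff_approx[OF n] by blast
    then show ?thesis
      using hull[of \<epsilon>] by (intro bexI[of _ "f z"]) (auto simp: diff isometry)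
  qed
  then show ?thesis
    using x by (auto simp: Delta_point_iff_approx[OF n] Delta_point_iff_approx[OF m] isometry)
qed

section \<open>Convexity estimates for absolute norms on the plane\<close>

lemma
  assumes "absolute_norm N"
  shows absolute_norm_triangle: "N (r + r', s + s') \<le> N (r, s) + N (r', s')"
    and absolute_norm_scale: "N (c * r, c * s) = \<bar>c\<bar> * N (r, s)"
proof -
  have "N (v + w) \<le> N v + N w" "N (t *\<^sub>R v) = \<bar>t\<bar> * N v" for v w t
    using assms unfolding absolute_norm_def is_norm_def by blast+
  from this(1)[of "(r, s)" "(r', s')"] this(2)[of c "(r, s)"]
  show "N (r + r', s + s') \<le> N (r, s) + N (r', s')" "N (c * r, c * s) = \<bar>c\<bar> * N (r, s)"
    by simp_all
qed

lemma absolute_norm_convex: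
  assumes N: "absolute_norm N" and "0 \<le> \<theta>" "0 \<le> \<theta>'"
  shows "N (\<theta> * r + \<theta>' * r', \<theta> * s + \<theta>' * s') \<le> \<theta> * N (r, s) + \<theta>' * N (r', s')"
  using absolute_norm_triangle[OF N, of "\<theta> * r" "\<theta>' * r'" "\<theta> * s" "\<theta>' * s'"] assms(2,3)
  by (simp add: absolute_norm_scale[OF N])

lemma normalised_axis:
  assumes N: "absolute_norm N" "normalised N"
  shows "N (r, 0) = \<bar>r\<bar>" "N (0, s) = \<bar>s\<bar>"
  using absolute_norm_scale[OF N(1), of r 1 0] absolute_norm_scale[OF N(1), of s 0 1] N(2)
  by (simp_all add: normalised_def)

lemma coordinates_le_absolute_norm:
  assumes N: "absolute_norm N" "normalised N" and "0 \<le> r" "0 \<le> s"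
  shows "r \<le> N (r, s)" "s \<le> N (r, s)"
  using absolute_norm_mono[OF N(1), of r r 0 s] absolute_norm_mono[OF N(1), of 0 r s s] assms
  by (simp_all add: normalised_axis)

text \<open>\<open>(\<theta> * r, s)\<close> lies on the segment from \<open>(0, s)\<close> to
  \<open>(r, s)\<close>, and \<open>N (0, s) = s\<close>.\<close>

lemma absolute_norm_shrink_fst:
  assumes N: "absolute_norm N" "normalised N" and "0 \<le> \<theta>" "\<theta> \<le> 1" "0 \<le> s"
  shows "N (\<theta> * r, s) \<le> \<theta> * N (r, s) + (1 - \<theta>) * s"
  using absolute_norm_convex[OF N(1), of \<theta> "1 - \<theta>" r 0 s s] assms
  by (simp add: normalised_axis algebra_simps)

text \<open>If \<open>p\<close> were smaller, monotonicity and the triangle inequality would split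
  off \<open>(s, t)\<close> and leave \<open>N (p, q) \<le> N (a - \<gamma>, b) + 1\<close>.
  Shrinking \<open>a\<close> by the factor \<open>1 - \<gamma> / a\<close> lowers
  \<open>N (a, b) = 1\<close> by at least \<open>\<gamma> / a * (1 - b)\<close>, which contradicts
  \<open>far\<close>.\<close>

lemma fst_almost_additive:
  assumes N: "absolute_norm N" "normalised N"
    and ab: "0 < a" "0 \<le> b" "N (a, b) = 1" and st: "0 \<le> s" "0 \<le> t" "N (s, t) \<le> 1"
    and pq: "0 \<le> p" "0 \<le> q" "q \<le> b + t" and \<gamma>: "0 \<le> \<gamma>" "\<gamma> \<le> a"
    and far: "N (p, q) > 2 - \<gamma> / a * (1 - b)"
  shows "p > a + s - \<gamma>"
proof (rule ccontr)
  assume "\<not> p > a + s - \<gamma>"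
  then have "N (p, q) \<le> N ((a - \<gamma>) + s, b + t)"
    using pq by (intro absolute_norm_mono[OF N(1)]) auto
  also have "\<dots> \<le> N (a - \<gamma>, b) + 1"
    using absolute_norm_triangle[OF N(1), of "a - \<gamma>" s b t] st by simp
  also have "N (a - \<gamma>, b) \<le> (1 - \<gamma> / a) + \<gamma> / a * b"
    using absolute_norm_shrink_fst[OF N, of "1 - \<gamma> / a" b a] ab \<gamma> by (simp add: left_diff_distrib)
  finally show False
    using far by (simp add: right_diff_distrib)
qed

text \<open>Let S > a. On the horizontal segment from the second axis to \<open>(S, T')\<close>, the
  point with first coordinate \<open>a\<close> has norm at least 1 - \<eta>, being close to or above
  \<open>(a, b)\<close>. Convexity bounds the same norm by
  \<open>\<theta> + (1 - \<theta>) * b\<close>, so \<open>\<theta> = a / S\<close> cannot be far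
  below 1.\<close>

lemma fst_excess_bound:
  assumes N: "absolute_norm N" "normalised N"
    and ab: "0 \<le> a" "0 \<le> b" "b < 1" "N (a, b) = 1"
    and ST: "0 \<le> S" "0 \<le> T" "N (S, T) \<le> 1" and T: "b - \<eta> \<le> T" and "0 \<le> \<eta>"
  shows "S - a \<le> \<eta> / (1 - b)"
proof (cases "S \<le> a")
  case True
  then show ?thesis
    using ab \<open>0 \<le> \<eta>\<close> by (smt (verit) divide_nonneg_pos)
next
  case False
  define \<theta> where "\<theta> = a / S"
  \<comment> \<open>\<open>T\<close> may exceed \<open>b\<close>; the cap gives the endpoint
    \<open>(0, T')\<close> norm at most b < 1, and by monotonicity keeps
    \<open>N (S, T') \<le> 1\<close>.\<close>
  define T' where "T' = min T b"
  have \<theta>: "0 \<le> \<theta>" "\<theta> \<le> 1" "\<theta> * S = a"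
    using False ab by (auto simp: \<theta>_def)
  have T': "0 \<le> T'" "T' \<le> T" "T' \<le> b" "b \<le> T' + \<eta>"
    using assms by (auto simp: T'_def)
  have "S \<le> 1"
    using coordinates_le_absolute_norm(1)[OF N ST(1,2)] ST(3) by simp
  have "1 \<le> N (a + 0, T' + \<eta>)"
    using absolute_norm_mono[OF N(1), of a a b "T' + \<eta>"] ab T' by simp
  also have "\<dots> \<le> N (\<theta> * S, T') + \<eta>"
    using absolute_norm_triangle[OF N(1), of a 0 T' \<eta>] \<theta> \<open>0 \<le> \<eta>\<close> by (simp add: normalised_axis N)
  also have "N (\<theta> * S, T') \<le> \<theta> * N (S, T') + (1 - \<theta>) * T'"
    using absolute_norm_shrink_fst[OF N \<theta>(1,2) T'(1)] .
  also have "\<dots> \<le> \<theta> * 1 + (1 - \<theta>) * b"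
    using absolute_norm_mono[OF N(1), of S S T' T] ST T' \<theta>
    by (intro add_mono mult_left_mono) auto
  finally have "(1 - \<theta>) * (1 - b) \<le> \<eta>"
    by (simp add: algebra_simps)
  then have "S * ((1 - \<theta>) * (1 - b)) \<le> 1 * \<eta>"
    using \<open>S \<le> 1\<close> ST \<theta> ab \<open>0 \<le> \<eta>\<close> by (intro mult_mono) auto
  moreover have "S * ((1 - \<theta>) * (1 - b)) = (S - \<theta> * S) * (1 - b)"
    by (simp add: algebra_simps)
  ultimately show ?thesis
    using ab \<theta> by (simp add: pos_le_divide_eq)
qed

section \<open>From the sum to its first summand\<close>

lemma norm_diff_of_scaled:
  fixes x w :: "'a::real_normed_vector"
  assumes xw: "norm x = 1" "norm w = 1" and m: "0 < m" "m \<le> a" "m \<le> s"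
    and far: "norm (a *\<^sub>R x - s *\<^sub>R w) \<ge> a + s - m * \<epsilon>"
  shows "norm (x - w) \<ge> 2 - \<epsilon>"
proof -
  \<comment> \<open>The remainder has norm at most \<open>(a - m) + (s - m)\<close>, so the whole
    deficit \<open>m * \<epsilon>\<close> falls on \<open>m *\<^sub>R (x - w)\<close>; division by
    \<open>m\<close> leaves \<epsilon>.\<close>
  have "a *\<^sub>R x - s *\<^sub>R w = m *\<^sub>R (x - w) + ((a - m) *\<^sub>R x - (s - m) *\<^sub>R w)"
    by (simp add: algebra_simps)
  also have "norm \<dots> \<le> m * norm (x - w) + ((a - m) + (s - m))"
    using m xw norm_triangle_ineq4[of "(a - m) *\<^sub>R x" "(s - m) *\<^sub>R w"]
    by (intro norm_triangle_le) simp
  finally have "m * (2 - \<epsilon>) \<le> m * norm (x - w)"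
    using far by (simp add: algebra_simps)
  then show ?thesis
    using m by simp
qed

text \<open>Lets an approximation known on a Delta-set pass to its convex hull. \<open>T\<close>
  only dominates \<open>norm q\<close>, since norms do not average exactly whereas the bounds
  \<open>(S, T)\<close> do.\<close>

lemma convex_approx_cone:
  fixes C :: "'a::real_normed_vector set"
  assumes C: "convex C" and N: "absolute_norm N"
  shows "convex {(p, q :: 'b::real_normed_vector). \<exists>S T W. 0 \<le> S \<and> norm q \<le> T \<and> N (S, T) \<le> 1 \<and>
    W \<in> C \<and> norm (p - S *\<^sub>R W) \<le> \<kappa>}" (is "convex ?K")
proof (rule convexI)
  fix z z' :: "'a \<times> 'b" and \<alpha> \<beta> :: real
  assume "z \<in> ?K" "z' \<in> ?K" and \<alpha>\<beta>: "0 \<le> \<alpha>" "0 \<le> \<beta>" "\<alpha> + \<beta> = 1"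
  then obtain p q S T W p' q' S' T' W' where z: "z = (p, q)" "z' = (p', q')"
    and 1: "0 \<le> S" "norm q \<le> T" "N (S, T) \<le> 1" "W \<in> C" "norm (p - S *\<^sub>R W) \<le> \<kappa>"
    and 2: "0 \<le> S'" "norm q' \<le> T'" "N (S', T') \<le> 1" "W' \<in> C" "norm (p' - S' *\<^sub>R W') \<le> \<kappa>"
    by auto
  define R where "R = \<alpha> * S + \<beta> * S'"
  have nonneg: "0 \<le> \<alpha> * S" "0 \<le> \<beta> * S'"
    using \<alpha>\<beta> 1(1) 2(1) by simp_all
  have "\<exists>V\<in>C. R *\<^sub>R V = (\<alpha> * S) *\<^sub>R W + (\<beta> * S') *\<^sub>R W'"
  \<comment> \<open>\<open>V\<close> is the mean of \<open>W\<close> and \<open>W'\<close> with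
    weights \<open>\<alpha> * S / R\<close> and \<open>\<beta> * S' / R\<close>; if R = 0, both
    terms vanish and any point of \<open>C\<close> serves.\<close>
  proof (cases "R = 0")
    case True
    then have "\<alpha> * S = 0" "\<beta> * S' = 0"
      using nonneg unfolding R_def by linarith+
    then show ?thesis
      using True 1(4) by force
  next
    case False
    then have "R > 0"
      using nonneg by (simp add: R_def)
    then have "(\<alpha> * S / R) *\<^sub>R W + (\<beta> * S' / R) *\<^sub>R W' \<in> C"
      using nonneg 1(4) 2(4)
      by (intro convexD[OF C]) (auto simp: R_def add_divide_distrib[symmetric])
    then show ?thesis
      using False by (intro bexI) (auto simp: scaleR_add_right)
  qed
  then obtain V where V: "V \<in> C" "R *\<^sub>R V = (\<alpha> * S) *\<^sub>R W + (\<beta> * S') *\<^sub>R W'"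
    by blast
  have "N (R, \<alpha> * T + \<beta> * T') \<le> \<alpha> * N (S, T) + \<beta> * N (S', T')"
    unfolding R_def by (rule absolute_norm_convex[OF N \<alpha>\<beta>(1,2)])
  also have "\<dots> \<le> 1"
    using convex_bound_le[OF 1(3) 2(3) \<alpha>\<beta>] by simp
  finally have R: "N (R, \<alpha> * T + \<beta> * T') \<le> 1" .
  have "norm (\<alpha> *\<^sub>R q + \<beta> *\<^sub>R q') \<le> \<alpha> * T + \<beta> * T'"
    using \<alpha>\<beta> 1(2) 2(2) by (intro norm_triangle_le add_mono) (simp_all add: mult_left_mono)
  moreover have "norm (\<alpha> *\<^sub>R p + \<beta> *\<^sub>R p' - R *\<^sub>R V) \<le> \<kappa>"
  proof -
    have "\<alpha> *\<^sub>R p + \<beta> *\<^sub>R p' - R *\<^sub>R V = \<alpha> *\<^sub>R (p - S *\<^sub>R W) + \<beta> *\<^sub>R (p' - S' *\<^sub>R W')"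
      by (simp add: V(2) algebra_simps)
    also have "norm \<dots> \<le> \<alpha> * norm (p - S *\<^sub>R W) + \<beta> * norm (p' - S' *\<^sub>R W')"
      using norm_triangle_ineq[of "\<alpha> *\<^sub>R (p - S *\<^sub>R W)" "\<beta> *\<^sub>R (p' - S' *\<^sub>R W')"] \<alpha>\<beta> by simp
    also have "\<dots> \<le> \<kappa>"
      using convex_bound_le[OF 1(5) 2(5) \<alpha>\<beta>] .
    finally show ?thesis .
  qed
  moreover have "0 \<le> R"
    using nonneg by (simp add: R_def)
  ultimately show "\<alpha> *\<^sub>R z + \<beta> *\<^sub>R z' \<in> ?K"
    using R V(1) by (auto simp: z)
qed

text \<open>For long \<open>u\<close> its direction serves as \<open>w\<close>. A short
  \<open>u\<close> is within 2\<kappa> of \<open>norm u *\<^sub>R (- x)\<close>, and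
  \<open>- x\<close> belongs to the Delta-set for every positive \<epsilon>.\<close>

lemma Delta_set_sum_norm_approx:
  fixes x :: "'a::real_normed_vector" and y :: "'b::real_normed_vector"
  assumes N: "absolute_norm N" "normalised N" and xy: "norm x = 1" "norm y = 1"
    and ab: "0 < a" "0 \<le> b" "b < 1" "N (a, b) = 1" and pos: "0 < \<epsilon>" "0 < \<kappa>"
  obtains \<delta> where "\<delta> > 0" and
    "\<And>u v. (u, v) \<in> Delta_set (sum_norm N) \<delta> (a *\<^sub>R x, b *\<^sub>R y) \<Longrightarrow>
      \<exists>w\<in>Delta_set norm \<epsilon> x. norm (u - norm u *\<^sub>R w) \<le> 2 * \<kappa>"
proof
  \<comment> \<open>\<open>m\<close> bounds both \<open>a\<close> and the length of a long
    \<open>u\<close> from below, as \<open>norm_diff_of_scaled\<close> demands;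
    \<open>\<gamma>\<close> is its slack \<open>m * \<epsilon>\<close>, capped by \<open>a\<close>
    for \<open>fst_almost_additive\<close>. Halving in \<open>\<delta>\<close> makes the distance
    inequality strict.\<close>
  define m where "m = min a \<kappa>"
  define \<gamma> where "\<gamma> = min a (m * \<epsilon>)"
  define \<delta> where "\<delta> = \<gamma> / a * (1 - b) / 2"
  have m: "0 < m" "m \<le> a" "m \<le> \<kappa>"
    using ab pos by (auto simp: m_def)
  have \<gamma>: "0 < \<gamma>" "\<gamma> \<le> a" "\<gamma> \<le> m * \<epsilon>"
    using ab pos m by (auto simp: \<gamma>_def)
  show "\<delta> > 0"
    using ab \<gamma> by (simp add: \<delta>_def)
  fix u v
  assume "(u, v) \<in> Delta_set (sum_norm N) \<delta> (a *\<^sub>R x, b *\<^sub>R y)"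
  then have ball: "N (norm u, norm v) \<le> 1"
    and "N (norm (a *\<^sub>R x - u), norm (b *\<^sub>R y - v)) \<ge> 2 - \<delta>"
    by (simp_all add: Delta_set_def sum_norm_def)
  moreover have "\<gamma> / a * (1 - b) > \<delta>"
    using \<open>\<delta> > 0\<close> by (simp add: \<delta>_def)
  ultimately have far: "N (norm (a *\<^sub>R x - u), norm (b *\<^sub>R y - v)) > 2 - \<gamma> / a * (1 - b)"
    by simp
  have "norm (b *\<^sub>R y - v) \<le> b + norm v"
    using norm_triangle_ineq4[of "b *\<^sub>R y" v] xy ab by simp
  then have diff: "norm (a *\<^sub>R x - u) > a + norm u - \<gamma>"
    using \<gamma> by (intro fst_almost_additive[OF N ab(1,2,4) _ _ ball _ _ _ _ _ far]) auto
  show "\<exists>w\<in>Delta_set norm \<epsilon> x. norm (u - norm u *\<^sub>R w) \<le> 2 * \<kappa>"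
  proof (cases "norm u \<le> \<kappa>")
    case True
    have "norm (x - (- x)) = 2"
      using xy norm_scaleR[of 2 x] by (simp add: scaleR_2)
    then have "- x \<in> Delta_set norm \<epsilon> x"
      using xy pos by (simp add: Delta_set_def)
    moreover have "norm (u - norm u *\<^sub>R (- x)) \<le> 2 * \<kappa>"
      using norm_triangle_ineq4[of u "norm u *\<^sub>R (- x)"] True xy by simp
    ultimately show ?thesis
      by blast
  next
    case False
    then have u: "norm u > 0" "m \<le> norm u"
      using pos m by linarith+
    define w where "w = u /\<^sub>R norm u"
    have w: "norm w = 1" "norm u *\<^sub>R w = u"
      using u by (auto simp: w_def)
    have "norm (x - w) \<ge> 2 - \<epsilon>"
      using diff \<gamma> by (intro norm_diff_of_scaled[OF xy(1) w(1) m(1,2) u(2)]) (simp add: w)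
    then show ?thesis
      using w pos by (intro bexI[of _ w]) (simp_all add: Delta_set_def)
  qed
qed

lemma Delta_point_sum_norm_fst:
  fixes x :: "'a::real_normed_vector" and y :: "'b::real_normed_vector"
  assumes N: "absolute_norm N" "normalised N" and xy: "norm x = 1" "norm y = 1"
    and ab: "0 \<le> a" "0 \<le> b" "N (a, b) = 1" "b \<noteq> 1"
    and Delta: "Delta_point (sum_norm N) (a *\<^sub>R x, b *\<^sub>R y)"
  shows "Delta_point norm x"
proof -
  have b: "b < 1"
    using coordinates_le_absolute_norm(2)[OF N ab(1,2)] ab by simp
  have a: "a > 0"
    using ab normalised_axis(2)[OF N, of b] by (cases "a = 0") auto
  have "\<exists>z\<in>convex hull (Delta_set norm \<epsilon> x). norm (x - z) < \<rho>" if \<epsilon>: "\<epsilon> > 0" and \<rho>: "\<rho> > 0" for \<epsilon> \<rho>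
  proof -
    \<comment> \<open>Error budget: \<open>\<eta> + 2 * \<kappa> \<le> a * \<rho> / 4\<close> bounds
      both the distance from \<open>a *\<^sub>R x\<close> to \<open>S *\<^sub>R W\<close> and
      \<open>a - S\<close>. The factor \<open>1 - b\<close> in \<open>\<eta>\<close> cancels the
      denominator in \<open>fst_excess_bound\<close>.\<close>
    define \<kappa> where "\<kappa> = a * \<rho> / 16"
    define \<eta> where "\<eta> = (1 - b) * (a * \<rho> / 8)"
    have \<kappa>: "\<kappa> > 0" and \<eta>: "\<eta> > 0" "\<eta> \<le> a * \<rho> / 8"
      using a b ab(2) \<rho> mult_right_mono[of "1 - b" 1 "a * \<rho> / 8"] by (auto simp: \<kappa>_def \<eta>_def)
    let ?C = "convex hull (Delta_set norm \<epsilon> x)"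
    obtain \<delta> where \<delta>: "\<delta> > 0" and approx:
      "\<And>u v. (u, v) \<in> Delta_set (sum_norm N) \<delta> (a *\<^sub>R x, b *\<^sub>R y) \<Longrightarrow>
        \<exists>w\<in>Delta_set norm \<epsilon> x. norm (u - norm u *\<^sub>R w) \<le> 2 * \<kappa>"
      using Delta_set_sum_norm_approx[OF N xy a ab(2) b ab(3) \<epsilon> \<kappa>] by metis
    let ?K = "{(p, q :: 'b). \<exists>S T W. 0 \<le> S \<and> norm q \<le> T \<and> N (S, T) \<le> 1 \<and>
      W \<in> ?C \<and> norm (p - S *\<^sub>R W) \<le> 2 * \<kappa>}"
    \<comment> \<open>The witnesses are \<open>S = norm u\<close>, \<open>T = norm v\<close> and the
      \<open>w\<close> supplied by \<open>approx\<close>.\<close>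
    have "Delta_set (sum_norm N) \<delta> (a *\<^sub>R x, b *\<^sub>R y) \<subseteq> ?K"
    proof clarify
      fix u v
      assume uv: "(u, v) \<in> Delta_set (sum_norm N) \<delta> (a *\<^sub>R x, b *\<^sub>R y)"
      then have "N (norm u, norm v) \<le> 1"
        by (simp add: Delta_set_def sum_norm_def)
      with approx[OF uv] show "\<exists>S T W. 0 \<le> S \<and> norm v \<le> T \<and> N (S, T) \<le> 1 \<and>
          W \<in> ?C \<and> norm (u - S *\<^sub>R W) \<le> 2 * \<kappa>"
        by (meson hull_inc norm_ge_zero order_refl)
    qed
    then have hull: "convex hull (Delta_set (sum_norm N) \<delta> (a *\<^sub>R x, b *\<^sub>R y)) \<subseteq> ?K"
      by (intro hull_minimal convex_approx_cone N convex_convex_hull)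
    obtain p q where pq: "(p, q) \<in> convex hull (Delta_set (sum_norm N) \<delta> (a *\<^sub>R x, b *\<^sub>R y))"
      "sum_norm N ((a *\<^sub>R x, b *\<^sub>R y) - (p, q)) < \<eta>"
      using Delta \<delta> \<eta>(1) unfolding Delta_point_iff_approx[OF is_norm_sum_norm[OF N(1)]] by fastforce
    obtain S T W where ST: "0 \<le> S" "norm q \<le> T" "N (S, T) \<le> 1" and W: "W \<in> ?C"
      and p: "norm (p - S *\<^sub>R W) \<le> 2 * \<kappa>"
      using hull pq(1) by blast
    have close: "norm (a *\<^sub>R x - p) < \<eta>" "norm (b *\<^sub>R y - q) < \<eta>"
      using pq(2) coordinates_le_absolute_norm[OF N, of "norm (a *\<^sub>R x - p)" "norm (b *\<^sub>R y - q)"]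
      by (simp_all add: sum_norm_def)
    have "?C \<subseteq> cball 0 1"
      by (intro hull_minimal) (auto simp: Delta_set_def)
    then have normW: "norm W \<le> 1"
      using W by auto
    have T: "0 \<le> T" "b - \<eta> \<le> T"
      using ST(2) norm_ge_zero[of q] close(2) norm_triangle_ineq2[of "b *\<^sub>R y" q] xy ab
      by (auto simp del: norm_ge_zero)
    have "S - a \<le> \<eta> / (1 - b)"
      using fst_excess_bound[OF N ab(1,2) b ab(3) ST(1) T(1) ST(3) T(2)] \<eta> by simp
    then have upper: "S - a \<le> a * \<rho> / 8"
      using b unfolding \<eta>_def by (metis less_irrefl nonzero_mult_div_cancel_left right_minus_eq)
    have axSW: "norm (a *\<^sub>R x - S *\<^sub>R W) < \<eta> + 2 * \<kappa>"
      using norm_triangle_ineq[of "a *\<^sub>R x - p" "p - S *\<^sub>R W"] close p by simp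
    \<comment> \<open>Lower bound for \<open>S\<close>: as \<open>W\<close> lies in the unit ball,
      \<open>S *\<^sub>R W\<close> can be close to \<open>a *\<^sub>R x\<close>, of norm
      \<open>a\<close>, only if \<open>S\<close> is not much below \<open>a\<close>.\<close>
    have "norm (S *\<^sub>R W) \<le> S"
      using normW ST(1) by (simp add: mult_left_le)
    then have "a - S < \<eta> + 2 * \<kappa>"
      using axSW norm_triangle_ineq2[of "a *\<^sub>R x" "S *\<^sub>R W"] xy ab by simp
    then have S: "\<bar>S - a\<bar> \<le> a * \<rho> / 4"
      using upper \<eta> mult_pos_pos[OF a \<rho>] unfolding \<kappa>_def by linarith
    have "a * norm (x - W) = norm ((a *\<^sub>R x - S *\<^sub>R W) + (S - a) *\<^sub>R W)"
      using a norm_scaleR[of a "x - W"] by (simp add: algebra_simps)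
    also have "\<dots> \<le> norm (a *\<^sub>R x - S *\<^sub>R W) + \<bar>S - a\<bar> * norm W"
      using norm_triangle_ineq[of "a *\<^sub>R x - S *\<^sub>R W" "(S - a) *\<^sub>R W"] by simp
    also have "\<dots> < a * \<rho>"
    proof -
      have "\<bar>S - a\<bar> * norm W \<le> a * \<rho> / 4"
        using S mult_left_le[OF normW abs_ge_zero, of "S - a"] by linarith
      then show ?thesis
        using axSW \<eta> by (simp add: \<kappa>_def mult.commute)
    qed
    finally show ?thesis
      using a W by auto
  qed
  then show ?thesis
    using xy by (simp add: Delta_point_iff_approx[OF is_norm_norm])
qed

section \<open>The second summand, by exchanging coordinates\<close>

lemma absolute_norm_swap:
  assumes "absolute_norm N"
  shows "absolute_norm (N \<circ> prod.swap)"
  using assms unfolding absolute_norm_def is_norm_def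
  by (auto simp: zero_prod_def)

theorem theorem4p1:
  fixes x :: "'a::banach" and y :: "'b::banach"
    and N :: "real \<times> real \<Rightarrow> real" and a b :: real
  assumes "norm x = 1" and "norm y = 1"
    and "absolute_norm N" and "normalised N"
    and "a \<ge> 0" and "b \<ge> 0" and "N (a, b) = 1"
    and "Delta_point (sum_norm N) (a *\<^sub>R x, b *\<^sub>R y)"
  shows "(b \<noteq> 1 \<longrightarrow> Delta_point norm x) \<and> (a \<noteq> 1 \<longrightarrow> Delta_point norm y)"
proof (intro conjI impI)
  show "Delta_point norm x" if "b \<noteq> 1"
    using Delta_point_sum_norm_fst[of N x y a b] assms that by blast
  have swap: "absolute_norm (N \<circ> prod.swap)"
    using assms by (intro absolute_norm_swap)
  \<comment> \<open>Swapping is a linear isometry onto the sum normed by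
    \<open>N \<circ> prod.swap\<close>, so the result for the first summand applies with
    \<open>x\<close>, \<open>a\<close> and \<open>y\<close>, \<open>b\<close> interchanged.\<close>
  have "linear (prod.swap :: 'a \<times> 'b \<Rightarrow> _)"
    by (rule linearI) auto
  from Delta_point_linear_isometry[OF is_norm_sum_norm[OF assms(3)] is_norm_sum_norm[OF swap] this _ assms(8)]
  have "Delta_point (sum_norm (N \<circ> prod.swap)) (b *\<^sub>R y, a *\<^sub>R x)"
    by (auto simp: sum_norm_def)
  then show "Delta_point norm y" if "a \<noteq> 1"
    using Delta_point_sum_norm_fst[of "N \<circ> prod.swap" y x b a] assms swap that
    by (auto simp: normalised_def)
qed

end
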